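(* In the standing setting of the context, assume: (a) there exists an open neighborhood $\mathcal{N}(t_0)\subset(0,1)^m$ of $t_0$ such that, for any $t\in\mathcal{N}(t_0)$, the $\phi$-projection $s^*$ of $t$ on $\mathcal{M}=\mathcal{S}(\bar\Theta)$ exists, is unique, and satisfies $s^*=\mathcal{S}(\theta^* )$ for some (unique) $\theta^*\in\mathring\Theta$; (b) with $\vartheta^*:\mathcal{N}(t_0)\to\mathring\Theta$ defined by $\vartheta^*(t)=\operatorname*{arg\,inf}_{\theta\in\mathring\Theta}D_\phi(\mathcal{S}(\theta)\mid t)$, the $k\times k$ matrix with entries $\frac{\partial^2 D_\phi(\mathcal{S}(\theta)\mid t_0)}{\partial\theta_i\partial\theta_j}\Big|_{\theta=\vartheta^*(t_0)}$, $i,j\in\{1,\dots,k\}$, is positive definite. Then $\vartheta^*$ is continuously differentiable at $t_0=(t_{0,1},\dots,t_{0,m})$ with Jacobian matrix at $t_0$ given by $$J[\vartheta^*](t_0)=J_2[D_\phi(\mathcal{S}(\cdot)\mid t_0)](\vartheta^*(t_0))^{-1}\,J[\mathcal{S}](\vartheta^*(t_0))^\top\,\Delta(t_0),$$ where, for $\theta\in\mathring\Theta$, $$J_2[D_\phi(\mathcal{S}(\cdot)\mid t_0)](\theta)=J[\mathcal{S}](\theta)^\top\,\mathrm{diag}\left(\frac{1}{t_{0,1}}\phi''\left(\frac{\mathcal{S}_1(\theta)}{t_{0,1}}\right),\dots,\frac{1}{t_{0,m}}\phi''\left(\frac{\mathcal{S}_m(\theta)}{t_{0,m}}\right)\right)J[\mathcal{S}](\theta)+\left(I_k\otimes\left(\phi'\left(\frac{\mathcal{S}_1(\theta)}{t_{0,1}}\right),\dots,\phi'\left(\frac{\mathcal{S}_m(\theta)}{t_{0,m}}\right)\right)^\top\right)J_2[\mathcal{S}](\theta)$$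 and $$\Delta(t_0)=\mathrm{diag}\left(\frac{\mathcal{S}_1(\vartheta^*(t_0))}{t_{0,1}^2}\phi''\left(\frac{\mathcal{S}_1(\vartheta^*(t_0))}{t_{0,1}}\right),\dots,\frac{\mathcal{S}_m(\vartheta^*(t_0))}{t_{0,m}^2}\phi''\left(\frac{\mathcal{S}_m(\vartheta^*(t_0))}{t_{0,m}}\right)\right).$$
   Context: Fix a positive integer $m$. The function $\phi:[0,\infty)\to\mathbb{R}$ is convex and continuous at $0$. Define $f:[0,\infty)^2\to\mathbb{R}\cup\{\infty\}$ by $f(v,w)=w\,\phi(v/w)$ if $v\ge 0$, $w>0$; $f(v,0)=v\lim_{x\to\infty}\phi(x)/x$ if $v>0$ (the limit exists in $\mathbb{R}\cup\{\infty\}$); and $f(0,0)=0$. For $s,t\in[0,\infty)^m$, $D_\phi(s\mid t)=\sum_{i=1}^m f(s_i,t_i)$. A $\phi$-projection of $t$ on a nonempty set $\mathcal{M}$ is an element $s^*\in\mathcal{M}$ with $D_\phi(s^*\mid t)=\inf_{s\in\mathcal{M}}D_\phi(s\mid t)$. Standing assumptions: $\phi$ is strictly convex and twice continuously differentiable on $(0,\infty)$. For some positive integer $k\le m$, $\Theta\subset\mathbb{R}^k$ is bounded, with closure $\bar\Theta$ and nonempty interior $\mathring\Theta$; $\mathcal{S}=(\mathcal{S}_1,\dots,\mathcal{S}_m):\bar\Theta\to[0,1]^m$ is continuous, injective, twice continuously differentiable on $\mathring\Theta$, and satisfies $\mathcal{S}(\mathring\Theta)\subset(0,1)^m$; and $\mathcal{M}=\mathcal{S}(\bar\Theta)$.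 A point $t_0\in(0,1)^m$ is fixed. Conventions: for $U\subset\mathbb{R}^a$ open and $g:U\to\mathbb{R}^{b\times c}$ with components $g_{i,j}$, the (column-major) vectorization $\overline{g}:U\to\mathbb{R}^{bc}$ has components $\overline{g}_{i+(j-1)b}=g_{i,j}$; $J[g](y)$ denotes the usual $bc\times a$ Jacobian matrix of $\overline{g}$ at $y$, and $J_2[g](y)=J[\overline{J[g]}](y)$. Thus $J[\mathcal{S}](\theta)$ is $m\times k$, $J_2[\mathcal{S}](\theta)$ is $mk\times k$, and $J_2$ of a real-valued function is its Hessian. Vectors in matrix expressions are one-column matrices; $\otimes$ is the Kronecker product; $I_k$ is the $k\times k$ identity. "Continuously differentiable at $t_0$" means differentiable on an open neighborhood of $t_0$ with Jacobian continuous at $t_0$. *)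

theory Defs
  imports "HOL-Analysis.Analysis"
begin

definition strict_convex_on :: "real set \<Rightarrow> (real \<Rightarrow> real) \<Rightarrow> bool" where
  "strict_convex_on C g \<longleftrightarrow> convex C \<and>
     (\<forall>x\<in>C. \<forall>y\<in>C. \<forall>u. x \<noteq> y \<longrightarrow> 0 < u \<longrightarrow> u < 1 \<longrightarrow>
        g (u * x + (1 - u) * y) < u * g x + (1 - u) * g y)"


section \<open>Divergences and projections\<close>

text \<open>Only arguments in \<open>[0,\<infinity>)\<close> are meaningful. For convex \<open>\<phi>\<close> the limit of \<open>\<phi> x / x\<close>
  exists in the extended reals and differs from \<open>-\<infinity>\<close>.\<close>

definition divergence_term :: "(real \<Rightarrow> real) \<Rightarrow> real \<Rightarrow> real \<Rightarrow> ereal" where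
  "divergence_term \<phi> v w =
     (if w > 0 then ereal (w * \<phi> (v / w))
      else if v > 0 then ereal v * Lim at_top (\<lambda>x. ereal (\<phi> x / x))
      else 0)"

definition phi_divergence :: "(real \<Rightarrow> real) \<Rightarrow> real^'m \<Rightarrow> real^'m \<Rightarrow> ereal" where
  "phi_divergence \<phi> s t = (\<Sum>i\<in>UNIV. divergence_term \<phi> (s $ i) (t $ i))"

definition is_phi_projection ::
  "(real \<Rightarrow> real) \<Rightarrow> (real^'m) set \<Rightarrow> real^'m \<Rightarrow> real^'m \<Rightarrow> bool" where
  "is_phi_projection \<phi> M t s \<longleftrightarrow>
     s \<in> M \<and> phi_divergence \<phi> s t = (INF s'\<in>M. phi_divergence \<phi> s' t)"

text \<open>The real-valued function \<open>\<theta> \<mapsto> D\<^sub>\<phi>(S(\<theta>) | t)\<close>. Nothing is lost by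
  \<^const>\<open>real_of_ereal\<close> if all components of \<open>t\<close> are positive, as then all terms are finite.\<close>

definition param_divergence ::
  "(real \<Rightarrow> real) \<Rightarrow> (real^'k \<Rightarrow> real^'m) \<Rightarrow> real^'m \<Rightarrow> real^'k \<Rightarrow> real" where
  "param_divergence \<phi> S t \<theta> = real_of_ereal (phi_divergence \<phi> (S \<theta>) t)"


section \<open>Matrices\<close>

definition diag :: "real^'n \<Rightarrow> real^'n^'n" where
  "diag v = (\<chi> i j. if i = j then v $ i else 0)"

definition pos_definite :: "real^'n^'n \<Rightarrow> bool" where
  "pos_definite A \<longleftrightarrow> transpose A = A \<and> (\<forall>x. x \<noteq> 0 \<longrightarrow> x \<bullet> (A *v x) > 0)"

text \<open>Indices that run over \<open>1, \<dots>, b * c\<close> are represented by pairs whose first component is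
  the major one. In the column-major vectorization of a \<open>b \<times> c\<close> matrix, position
  \<open>i + (j - 1) * b\<close> is thus the pair \<open>(j, i)\<close>; the block structure of the Kronecker product
  follows the same order.\<close>

definition vectorize :: "real^'c^'b \<Rightarrow> real^('c \<times> 'b)" where
  "vectorize A = (\<chi> p. A $ snd p $ fst p)"

definition kronecker :: "real^'c^'b \<Rightarrow> real^'e^'d \<Rightarrow> real^('c \<times> 'e)^('b \<times> 'd)" where
  "kronecker A B = (\<chi> p q. A $ fst p $ fst q * B $ snd p $ snd q)"

text \<open>Identification of a \<open>(b * 1) \<times> c\<close> matrix with a \<open>b \<times> c\<close> matrix.\<close>

definition drop_unit :: "real^'c^('b \<times> 1) \<Rightarrow> real^'c^'b" where
  "drop_unit A = (\<chi> i. A $ (i, 1))"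


section \<open>First and second derivatives\<close>

definition J :: "(real^'a \<Rightarrow> real^'b) \<Rightarrow> real^'a \<Rightarrow> real^'a^'b" where
  "J g y = jacobian g (at y)"

definition J2 :: "(real^'a \<Rightarrow> real^'b) \<Rightarrow> real^'a \<Rightarrow> real^'a^('a \<times> 'b)" where
  "J2 g = J (\<lambda>z. vectorize (J g z))"

text \<open>\<open>J\<^sub>2\<close> of a real-valued function, regarded as a function into \<open>real^1\<close>.\<close>

definition J2_real :: "(real^'a \<Rightarrow> real) \<Rightarrow> real^'a \<Rightarrow> real^'a^'a" where
  "J2_real g y = drop_unit (J2 (\<lambda>z. vec (g z) :: real^1) y)"

definition partial :: "'a \<Rightarrow> (real^'a \<Rightarrow> real) \<Rightarrow> real^'a \<Rightarrow> real" where
  "partial i g y = deriv (\<lambda>h. g (y + h *\<^sub>R axis i 1)) 0"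

text \<open>The following two notions are meant for open \<open>U\<close>.\<close>

definition twice_diff_on :: "(real^'a) set \<Rightarrow> (real^'a \<Rightarrow> real^'b) \<Rightarrow> bool" where
  "twice_diff_on U g \<longleftrightarrow>
     (\<forall>y\<in>U. g differentiable (at y) \<and> (\<lambda>z. vectorize (J g z)) differentiable (at y))"

definition twice_cont_diff_on :: "(real^'a) set \<Rightarrow> (real^'a \<Rightarrow> real^'b) \<Rightarrow> bool" where
  "twice_cont_diff_on U g \<longleftrightarrow> twice_diff_on U g \<and> continuous_on U (J2 g)"

definition cont_diff_at :: "(real^'a \<Rightarrow> real^'b) \<Rightarrow> real^'a \<Rightarrow> bool" where
  "cont_diff_at g y \<longleftrightarrow>
     (\<exists>U. open U \<and> y \<in> U \<and> (\<forall>z\<in>U. g differentiable (at z))) \<and> isCont (J g) y"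

end

theory Submission
  imports Defs
begin

text \<open>For \<open>t\<close> near \<open>t\<^sub>0\<close> the minimizer \<open>\<vartheta>(t)\<close> over \<open>closure \<Theta>\<close> is unique, so compactness makes
  \<open>\<vartheta>\<close> continuous. It solves \<open>G(\<vartheta>(t), t) = 0\<close>, where \<open>G\<close> is the gradient of
  \<open>\<theta> \<mapsto> D\<^sub>\<phi>(S(\<theta>) | t)\<close>. As continuity of this solution is already known, linearising \<open>G\<close> at
  \<open>(\<vartheta>(t), t)\<close> gives the derivative \<open>- (\<partial>\<^sub>\<theta> G)\<inverse> \<partial>\<^sub>t G\<close> directly, without an implicit
  function theorem. Invertibility of \<open>\<partial>\<^sub>\<theta> G\<close> persists near \<open>t\<^sub>0\<close>, and Cramer's rule shows that
  the Jacobian is continuous there.\<close>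

section \<open>Componentwise derivatives and Jacobian matrices\<close>

lemma has_derivative_vecI:
  fixes f :: "'a::real_normed_vector \<Rightarrow> real^'n"
  assumes "\<And>i. ((\<lambda>x. f x $ i) has_derivative (\<lambda>h. f' h $ i)) (at x within T)"
  shows "(f has_derivative f') (at x within T)"
  using assms
  by (subst has_derivative_componentwise_within) (auto simp: Basis_vec_def inner_axis)

lemma has_derivative_vec_nth:
  fixes f :: "'a::real_normed_vector \<Rightarrow> real^'n"
  assumes "(f has_derivative f') (at x within T)"
  shows "((\<lambda>x. f x $ i) has_derivative (\<lambda>h. f' h $ i)) (at x within T)"
  by (rule bounded_linear.has_derivative[OF bounded_linear_vec_nth assms])

lemma J_eqI: "(f has_derivative (\<lambda>h. A *v h)) (at x) \<Longrightarrow> J f x = A"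
  unfolding J_def jacobian_def
  by (simp add: frechet_derivative_at[symmetric] matrix_of_matrix_vector_mul)

lemma has_derivative_J: "f differentiable (at x) \<Longrightarrow> (f has_derivative (\<lambda>h. J f x *v h)) (at x)"
  unfolding J_def by (simp add: jacobian_works[symmetric])

text \<open>Being differentiable and having a given Jacobian are local properties. This serves to
  differentiate a Jacobian once more when a formula for it is known only on an open set.\<close>

lemma J_cong_open:
  assumes "open U" "x \<in> U" "\<And>y. y \<in> U \<Longrightarrow> f y = g y" "(f has_derivative (\<lambda>h. A *v h)) (at x)"
  shows "g differentiable (at x)" "J g x = A"
proof -
  have "(g has_derivative (\<lambda>h. A *v h)) (at x)"
    using has_derivative_transform_within_open[OF assms(4,1,2)] assms(3) by auto
  then show "g differentiable (at x)" "J g x = A" by (auto intro: differentiableI J_eqI)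
qed

section \<open>Continuity of determinants and inverse matrices\<close>

lemma isCont_vecI:
  fixes f :: "'a::t2_space \<Rightarrow> 'b::topological_space^'n"
  assumes "\<And>i. isCont (\<lambda>x. f x $ i) a"
  shows "isCont f a"
  using assms by (auto simp: isCont_def intro: vec_tendstoI)

lemma isCont_det:
  fixes A :: "'a::t2_space \<Rightarrow> real^'n^'n"
  assumes "\<And>i j. isCont (\<lambda>x. A x $ i $ j) a"
  shows "isCont (\<lambda>x. det (A x)) a"
  unfolding det_def by (intro continuous_intros assms)

lemma matrix_inv:
  fixes A :: "real^'n^'n"
  assumes "invertible A"
  shows matrix_inv_right: "A ** matrix_inv A = mat 1" and matrix_inv_left: "matrix_inv A ** A = mat 1"
  using someI_ex[OF assms[unfolded invertible_def]] by (auto simp: matrix_inv_def)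

text \<open>Column \<open>j\<close> of the inverse solves \<open>A *v x = axis j 1\<close>, and
  Cramer's rule gives its entries. The inverse thus becomes a quotient of determinants, whose
  continuity is evident.\<close>

lemma matrix_inv_nth:
  fixes A :: "real^'n^'n"
  assumes "det A \<noteq> 0"
  shows "matrix_inv A $ k $ j = det (\<chi> i l. if l = k then axis j 1 $ i else A $ i $ l) / det A"
proof -
  have "A *v (matrix_inv A *v axis j 1) = axis j 1"
    using assms by (simp add: matrix_vector_mul_assoc matrix_inv_right invertible_det_nz)
  then have "matrix_inv A *v axis j 1 = (\<chi> k. det (\<chi> i l. if l = k then axis j 1 $ i else A $ i $ l) / det A)"
    by (simp add: cramer[OF assms])
  moreover have "matrix_inv A $ k $ j = (matrix_inv A *v axis j 1) $ k"
    by (simp add: matrix_vector_mult_basis column_def)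
  ultimately show ?thesis by simp
qed

text \<open>The determinant stays nonzero near \<open>a\<close>, so Cramer's formula holds on a
  whole neighbourhood and its continuity passes to the inverse.\<close>

lemma isCont_matrix_inv:
  fixes A :: "'a::t2_space \<Rightarrow> real^'n^'n"
  assumes cont: "\<And>i j. isCont (\<lambda>x. A x $ i $ j) a" and nz: "det (A a) \<noteq> 0"
  shows "isCont (\<lambda>x. matrix_inv (A x) $ k $ j) a"
proof -
  have cont_det: "isCont (\<lambda>x. det (A x)) a" by (rule isCont_det[OF cont])
  have "isCont (\<lambda>x. det (\<chi> i l. if l = k then axis j 1 $ i else A x $ i $ l) / det (A x)) a"
  proof (intro isCont_divide cont_det isCont_det nz)
    show "isCont (\<lambda>x. (\<chi> i l. if l = k then axis j 1 $ i else A x $ i $ l) $ i $ l) a" for i l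
      by (cases "l = k") (simp_all add: cont)
  qed
  moreover have "\<forall>\<^sub>F x in nhds a. det (A x) \<noteq> 0"
    using tendsto_imp_eventually_ne[OF cont_det[unfolded isCont_def] nz] nz
    by (simp add: eventually_nhds_conv_at)
  then have "\<forall>\<^sub>F x in nhds a. matrix_inv (A x) $ k $ j =
      det (\<chi> i l. if l = k then axis j 1 $ i else A x $ i $ l) / det (A x)"
    by (rule eventually_mono) (rule matrix_inv_nth)
  ultimately show ?thesis by (simp add: isCont_cong)
qed

section \<open>Continuity and differentiability of implicitly defined maps\<close>

text \<open>A map into a compact set is continuous once its graph is closed. Uniqueness identifies
  the graph with the set of all pairs \<open>(t, z)\<close> such that
  \<open>f (t, z) \<le> f (t, y)\<close> for each \<open>y\<close> in \<open>K\<close>, and each of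
  these conditions is closed.\<close>

lemma continuous_on_unique_minimizer:
  fixes x :: "'a::euclidean_space \<Rightarrow> 'b::euclidean_space" and f :: "'a \<times> 'b \<Rightarrow> real"
  assumes K: "compact K" and f: "continuous_on (N \<times> K) f"
    and x: "\<And>t. t \<in> N \<Longrightarrow> x t \<in> K" "\<And>t y. t \<in> N \<Longrightarrow> y \<in> K \<Longrightarrow> f (t, x t) \<le> f (t, y)"
    and unique: "\<And>t y. t \<in> N \<Longrightarrow> y \<in> K \<Longrightarrow> f (t, y) \<le> f (t, x t) \<Longrightarrow> y = x t"
  shows "continuous_on N x"
proof (cases "K = {}")
  case True
  then have "N = {}" using x(1) by auto
  then show ?thesis by simp
next
  case False
  \<comment> \<open>Nonemptiness of \<open>K\<close> matters here: an empty intersection would be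
    the whole space and not a subset of \<open>N \<times> K\<close>.\<close>
  have "(\<lambda>t. (t, x t)) ` N = (\<Inter>y\<in>K. {p \<in> N \<times> K. f p \<le> f (fst p, y)})"
  proof (rule set_eqI, rule iffI)
    fix p assume "p \<in> (\<Inter>y\<in>K. {p \<in> N \<times> K. f p \<le> f (fst p, y)})"
    then have p: "fst p \<in> N" "snd p \<in> K" "\<And>y. y \<in> K \<Longrightarrow> f (fst p, snd p) \<le> f (fst p, y)"
      using False by auto
    then have "snd p = x (fst p)" using unique x(1) by blast
    then show "p \<in> (\<lambda>t. (t, x t)) ` N" using p(1) by (cases p) auto
  qed (use x in auto)
  moreover have "closedin (top_of_set (N \<times> K)) {p \<in> N \<times> K. f p \<le> f (fst p, y)}" if "y \<in> K" for y
  proof -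
    have "continuous_on (N \<times> K) (\<lambda>p. f (fst p, y) - f p)"
      using that by (intro continuous_intros f continuous_on_compose2[OF f]) auto
    then have "closedin (top_of_set (N \<times> K)) (N \<times> K \<inter> (\<lambda>p. f (fst p, y) - f p) -` {0..})"
      by (rule continuous_closedin_preimage) simp
    moreover have "N \<times> K \<inter> (\<lambda>p. f (fst p, y) - f p) -` {0..} = {p \<in> N \<times> K. f p \<le> f (fst p, y)}"
      by auto
    ultimately show ?thesis by simp
  qed
  ultimately have "closedin (top_of_set (N \<times> K)) ((\<lambda>t. (t, x t)) ` N)"
    using False by (auto intro!: closedin_INT)
  then show ?thesis
    using x(1) by (subst continuous_closed_graph_eq[OF K]) auto
qed

text \<open>With \<open>u = x s - x t\<close> and \<open>h = s - t\<close>, linearising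
  \<open>G = 0\<close> makes \<open>A u + B h\<close> small compared with
  \<open>norm u + norm h\<close>. Applying the left inverse \<open>L\<close> of \<open>A\<close>
  gives the same for \<open>u + L (B h)\<close>, and the share of \<open>norm u\<close> in the error
  can be absorbed.\<close>

lemma has_derivative_implicit:
  fixes x :: "'a::real_normed_vector \<Rightarrow> 'b::real_normed_vector"
    and G :: "'b \<times> 'a \<Rightarrow> 'c::real_normed_vector"
  assumes G: "(G has_derivative (\<lambda>(u, h). A u + B h)) (at (x t, t))"
    and x: "isCont x t"
    and zero: "\<forall>\<^sub>F s in nhds t. G (x s, s) = 0"
    and L: "bounded_linear L" "\<And>u. L (A u) = u"
  shows "(x has_derivative (\<lambda>h. - L (B h))) (at t)"
proof -
  interpret L: bounded_linear L by (rule L)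
  \<comment> \<open>Boundedness is known only for the joint map in \<open>(u, h)\<close>. Composing
    it with \<open>h \<mapsto> (0, h)\<close> and then with \<open>L\<close> leaves
    \<open>L (A 0 + B h) = L (B h)\<close>.\<close>
  have "bounded_linear (\<lambda>h. - L ((\<lambda>(u, h). A u + B h) (0, h)))"
    by (intro bounded_linear_minus bounded_linear_compose[OF L(1)]
          bounded_linear_compose[OF has_derivative_bounded_linear[OF G]]
          bounded_linear_Pair bounded_linear_zero bounded_linear_ident)
  then have LB: "bounded_linear (\<lambda>h. - L (B h))" by (simp add: L.add L(2))
  then obtain M where M: "M > 0" "\<And>h. norm (- L (B h)) \<le> norm h * M"
    using bounded_linear.pos_bounded by blast
  obtain K where K: "K > 0" "\<And>v. norm (L v) \<le> norm v * K"
    using L.pos_bounded by blast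
  have G0: "G (x t, t) = 0" using eventually_nhds_x_imp_x[OF zero] .
  have "\<forall>\<^sub>F s in at t. norm (x s - x t - - L (B (s - t))) \<le> e * norm (s - t)" if "e > 0" for e
  proof -
    \<comment> \<open>The bound 1/2 lets \<open>norm u\<close> be absorbed, which yields
      \<open>norm u \<le> (2 * M + 1) * norm h\<close>. Then \<open>norm u + norm h\<close> is at
      most \<open>(2 * M + 2) * norm h\<close>, and the second bound on \<open>c\<close> turns this
      into \<open>e * norm h\<close>.\<close>
    define c where "c = min (1 / 2) (e / (2 * M + 2))"
    have c: "c > 0" "c \<le> 1 / 2" and "c \<le> e / (2 * M + 2)"
      using that M(1) unfolding c_def by (simp, intro min.cobounded1, intro min.cobounded2)
    then have ce: "c * (2 * M + 2) \<le> e"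
      using M(1) by (simp add: pos_le_divide_eq)
    \<comment> \<open>The tolerance is divided by \<open>K\<close> because \<open>L\<close> may
      enlarge norms by that factor.\<close>
    have "\<forall>\<^sub>F p in nhds (x t, t). norm (G p - G (x t, t) - (\<lambda>(u, h). A u + B h) (p - (x t, t)))
        \<le> c / K * norm (p - (x t, t))"
    proof -
      have "c / K > 0" using c K by simp
      then obtain d where "d > 0" "\<And>p. norm (p - (x t, t)) < d \<Longrightarrow>
          norm (G p - G (x t, t) - (\<lambda>(u, h). A u + B h) (p - (x t, t))) \<le> c / K * norm (p - (x t, t))"
        using G unfolding has_derivative_at_alt by blast
      then show ?thesis by (auto simp: eventually_nhds_metric dist_norm)
    qed
    moreover have "filterlim (\<lambda>s. (x s, s)) (nhds (x t, t)) (at t)"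
      using x by (intro tendsto_Pair tendsto_ident_at) (simp add: isCont_def)
    ultimately have "\<forall>\<^sub>F s in at t. norm (G (x s, s) - G (x t, t)
        - (\<lambda>(u, h). A u + B h) ((x s, s) - (x t, t))) \<le> c / K * norm ((x s, s) - (x t, t))"
      by (rule eventually_compose_filterlim)
    moreover have "\<forall>\<^sub>F s in at t. G (x s, s) = 0"
      using zero by (simp add: eventually_nhds_conv_at)
    ultimately show ?thesis
    proof eventually_elim
      case (elim s)
      define u h where "u = x s - x t" and "h = s - t"
      have "norm (A u + B h) \<le> c / K * norm (u, h)"
        using elim G0 norm_minus_cancel[of "A u + B h"]
        by (simp add: u_def h_def del: norm_minus_cancel)
      also have "\<dots> \<le> c / K * (norm u + norm h)"
        using c K norm_Pair_le[of u h] by (intro mult_left_mono) auto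
      finally have "norm (A u + B h) \<le> c / K * (norm u + norm h)" .
      then have "norm (A u + B h) * K \<le> c * (norm u + norm h)"
        using K by (simp add: field_simps)
      moreover have "L (A u + B h) = u - - L (B h)" by (simp add: L.add L(2))
      ultimately have *: "norm (u - - L (B h)) \<le> c * (norm u + norm h)"
        using K(2)[of "A u + B h"] by simp
      have "norm u \<le> norm (u - - L (B h)) + norm (- L (B h))"
        by (metis diff_add_cancel norm_triangle_ineq)
      also have "\<dots> \<le> 1 / 2 * (norm u + norm h) + norm h * M"
        by (intro add_mono order_trans[OF * mult_right_mono] M(2) c(2)) simp
      finally have "norm u \<le> (2 * M + 1) * norm h" by (simp add: field_simps)
      then have "c * (norm u + norm h) \<le> c * ((2 * M + 2) * norm h)"
        using c(1) by (intro mult_left_mono) (auto simp: algebra_simps)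
      also have "\<dots> \<le> e * norm h"
        using mult_right_mono[OF ce, of "norm h"] by (simp add: mult.assoc)
      finally show ?case using * unfolding u_def h_def by linarith
    qed
  qed
  then show ?thesis using LB unfolding has_derivative_within_alt2 by blast
qed

section \<open>Partial derivatives\<close>

lemma DERIV_line:
  assumes "(g has_derivative g') (at y)"
  shows "((\<lambda>h::real. g (y + h *\<^sub>R v)) has_field_derivative (g' v :: real)) (at 0)"
proof -
  have "((\<lambda>h. y + h *\<^sub>R v) has_derivative (\<lambda>h. h *\<^sub>R v)) (at 0)"
    by (auto intro!: derivative_eq_intros)
  from has_derivative_compose[OF this, of g g'] assms
  have "((\<lambda>h. g (y + h *\<^sub>R v)) has_derivative (\<lambda>h. g' (h *\<^sub>R v))) (at 0)" by simp
  moreover have "g' (h *\<^sub>R v) = g' v * h" for h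
    using linear_cmul[OF has_derivative_linear[OF assms]] by simp
  ultimately show ?thesis by (simp add: has_field_derivative_def)
qed

lemma partial_eqI:
  assumes "(g has_derivative g') (at y)"
  shows "partial i g y = g' (axis i 1)"
  unfolding partial_def by (rule DERIV_imp_deriv[OF DERIV_line[OF assms]])

section \<open>Gradient and Hessian of the divergence in coordinates\<close>

text \<open>\<open>U\<close> stands for the interior of the parameter set. Positivity of
  \<open>S\<close> there keeps the arguments of \<open>\<phi>\<close> in the open half-line, where
  \<open>\<phi>\<close> is smooth.\<close>

locale parametric_divergence =
  fixes \<phi> :: "real \<Rightarrow> real" and S :: "real^'k \<Rightarrow> real^'m" and U :: "(real^'k) set"
  assumes phi_diff: "\<And>x. x > 0 \<Longrightarrow> \<phi> differentiable (at x)"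
    and phi_diff2: "\<And>x. x > 0 \<Longrightarrow> deriv \<phi> differentiable (at x)"
    and phi_C2: "continuous_on {0<..} (deriv (deriv \<phi>))"
    and open_U: "open U"
    and S_C2: "twice_cont_diff_on U S"
    and S_pos: "\<And>\<theta> i. \<theta> \<in> U \<Longrightarrow> S \<theta> $ i > 0"
begin

text \<open>This is the real value of \<open>phi_divergence\<close> when all components of
  \<open>t\<close> are positive, so that no limit at infinity enters.\<close>

definition divergence :: "real^'m \<Rightarrow> real^'k \<Rightarrow> real" where
  "divergence t \<theta> = (\<Sum>i\<in>UNIV. t $ i * \<phi> (S \<theta> $ i / t $ i))"

definition gradient :: "real^'m \<Rightarrow> real^'k \<Rightarrow> real^'k" where
  "gradient t \<theta> = (\<chi> j. \<Sum>i\<in>UNIV. deriv \<phi> (S \<theta> $ i / t $ i) * J S \<theta> $ i $ j)"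

text \<open>Row \<open>j\<close> is the derivative of component \<open>j\<close> of the gradient.
  The pair \<open>(j, i)\<close> is the position of the entry in row \<open>i\<close> and column
  \<open>j\<close> of \<open>J S\<close> after column-major vectorization.\<close>

definition hessian :: "real^'m \<Rightarrow> real^'k \<Rightarrow> real^'k^'k" where
  "hessian t \<theta> = (\<chi> j l. \<Sum>i\<in>UNIV.
     deriv (deriv \<phi>) (S \<theta> $ i / t $ i) / t $ i * J S \<theta> $ i $ l * J S \<theta> $ i $ j
     + deriv \<phi> (S \<theta> $ i / t $ i) * J2 S \<theta> $ (j, i) $ l)"

text \<open>Minus the derivative of the gradient with respect to \<open>t\<close>.\<close>

definition cross :: "real^'m \<Rightarrow> real^'k \<Rightarrow> real^'m^'k" where
  "cross t \<theta> = (\<chi> j i. deriv (deriv \<phi>) (S \<theta> $ i / t $ i) * (S \<theta> $ i / (t $ i)\<^sup>2) * J S \<theta> $ i $ j)"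

lemma DERIV_phi: "x > 0 \<Longrightarrow> (\<phi> has_field_derivative deriv \<phi> x) (at x)"
  and DERIV_deriv_phi: "x > 0 \<Longrightarrow> (deriv \<phi> has_field_derivative deriv (deriv \<phi>) x) (at x)"
  using phi_diff phi_diff2 by (simp_all add: DERIV_deriv_iff_real_differentiable)

lemma has_derivative_S:
  assumes "\<theta> \<in> U"
  shows "((\<lambda>\<theta>. S \<theta> $ i) has_derivative (\<lambda>h. \<Sum>l\<in>UNIV. J S \<theta> $ i $ l * h $ l)) (at \<theta>)"
proof -
  have "S differentiable (at \<theta>)"
    using S_C2 assms by (simp add: twice_cont_diff_on_def twice_diff_on_def)
  from has_derivative_vec_nth[OF has_derivative_J[OF this]] show ?thesis
    by (simp add: matrix_vector_mult_def)
qed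

lemma has_derivative_J_S:
  assumes "\<theta> \<in> U"
  shows "((\<lambda>\<theta>. J S \<theta> $ i $ j) has_derivative (\<lambda>h. \<Sum>l\<in>UNIV. J2 S \<theta> $ (j, i) $ l * h $ l)) (at \<theta>)"
proof -
  have "(\<lambda>\<theta>. vectorize (J S \<theta>)) differentiable (at \<theta>)"
    using S_C2 assms by (simp add: twice_cont_diff_on_def twice_diff_on_def)
  from has_derivative_vec_nth[OF has_derivative_J[OF this], of "(j, i)"] show ?thesis
    by (simp add: matrix_vector_mult_def vectorize_def J2_def)
qed

lemma isCont_S: "\<theta> \<in> U \<Longrightarrow> isCont (\<lambda>\<theta>. S \<theta> $ i) \<theta>"
  using has_derivative_S by (rule has_derivative_continuous)

lemma isCont_J_S: "\<theta> \<in> U \<Longrightarrow> isCont (\<lambda>\<theta>. J S \<theta> $ i $ j) \<theta>"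
  using has_derivative_J_S by (rule has_derivative_continuous)

lemma isCont_J2_S: "\<theta> \<in> U \<Longrightarrow> isCont (\<lambda>\<theta>. J2 S \<theta> $ p $ l) \<theta>"
  using S_C2 open_U
  by (intro isCont_vec_nth) (simp add: twice_cont_diff_on_def continuous_on_eq_continuous_at)

lemma isCont_deriv_phi: "x > 0 \<Longrightarrow> isCont (deriv \<phi>) x"
  using DERIV_deriv_phi by (rule DERIV_isCont)

lemma isCont_deriv2_phi: "x > 0 \<Longrightarrow> isCont (deriv (deriv \<phi>)) x"
  using phi_C2 by (simp add: continuous_on_eq_continuous_at)

text \<open>Here \<open>x\<close> is to be the optimal parameter as a function of \<open>t\<close>.
  The lemma provides the continuity of both factors in the formula for its Jacobian.\<close>

lemma isCont_hessian_cross: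
  assumes x: "isCont x t" "x t \<in> U" and t: "\<And>i. t $ i > 0"
  shows "isCont (\<lambda>t. hessian t (x t) $ j $ l) t" "isCont (\<lambda>t. cross t (x t) $ j $ i) t"
proof -
  have S: "isCont (\<lambda>t. S (x t) $ i) t" and JS: "isCont (\<lambda>t. J S (x t) $ i $ j) t"
    and J2S: "isCont (\<lambda>t. J2 S (x t) $ p $ j) t" for i j p
    using x isCont_o2[OF x(1) isCont_S] isCont_o2[OF x(1) isCont_J_S] isCont_o2[OF x(1) isCont_J2_S]
    by auto
  have t0: "t $ i \<noteq> 0" for i using t[of i] by simp
  have q: "isCont (\<lambda>t. S (x t) $ i / t $ i) t" for i
    using t0 by (intro isCont_divide S continuous_intros)
  have pos: "S (x t) $ i / t $ i > 0" for i using S_pos[OF x(2)] t by simp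
  have d: "isCont (\<lambda>t. deriv \<phi> (S (x t) $ i / t $ i)) t"
    and d2: "isCont (\<lambda>t. deriv (deriv \<phi>) (S (x t) $ i / t $ i)) t" for i
    using isCont_o2[OF q isCont_deriv_phi[OF pos]] isCont_o2[OF q isCont_deriv2_phi[OF pos]] by auto
  show "isCont (\<lambda>t. hessian t (x t) $ j $ l) t" "isCont (\<lambda>t. cross t (x t) $ j $ i) t"
    unfolding hessian_def cross_def vec_lambda_beta
    by (intro continuous_intros isCont_divide d d2 S JS J2S; simp add: t0)+
qed

text \<open>By the chain rule, the weight \<open>t $ i\<close> cancels the denominator of the inner
  derivative. Hence the gradient depends on \<open>t\<close> only through the quotients
  \<open>S \<theta> $ i / t $ i\<close>.\<close>

lemma has_derivative_divergence:
  assumes \<theta>: "\<theta> \<in> U" and t: "\<And>i. t $ i > 0"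
  shows "(divergence t has_derivative (\<lambda>h. gradient t \<theta> \<bullet> h)) (at \<theta>)"
proof -
  have t0: "t $ i \<noteq> 0" for i using t[of i] by simp
  have pos: "S \<theta> $ i / t $ i > 0" for i using S_pos[OF \<theta>] t by simp
  have "((\<lambda>\<theta>. t $ i * \<phi> (S \<theta> $ i / t $ i)) has_derivative
      (\<lambda>h. deriv \<phi> (S \<theta> $ i / t $ i) * (\<Sum>l\<in>UNIV. J S \<theta> $ i $ l * h $ l))) (at \<theta>)" for i
  proof -
    have "((\<lambda>\<theta>. S \<theta> $ i / t $ i) has_derivative (\<lambda>h. (\<Sum>l\<in>UNIV. J S \<theta> $ i $ l * h $ l) / t $ i)) (at \<theta>)"
      by (rule bounded_linear.has_derivative[OF bounded_linear_divide has_derivative_S[OF \<theta>]])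
    from has_derivative_mult_right[OF DERIV_compose_FDERIV[OF _ this], of \<phi>, OF DERIV_phi, OF pos, of "t $ i"]
    show ?thesis by (simp add: t0 mult.commute)
  qed
  then have "(divergence t has_derivative
      (\<lambda>h. \<Sum>i\<in>UNIV. deriv \<phi> (S \<theta> $ i / t $ i) * (\<Sum>l\<in>UNIV. J S \<theta> $ i $ l * h $ l))) (at \<theta>)"
    unfolding divergence_def by (intro has_derivative_sum)
  moreover have "(\<Sum>i\<in>UNIV. deriv \<phi> (S \<theta> $ i / t $ i) * (\<Sum>l\<in>UNIV. J S \<theta> $ i $ l * h $ l))
      = gradient t \<theta> \<bullet> h" for h
    unfolding gradient_def inner_vec_def
    by (simp add: sum_distrib_left sum_distrib_right mult.assoc) (rule sum.swap)
  ultimately show ?thesis by simp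
qed

text \<open>Product and quotient rules, applied in both variables at once, give the linearisation
  needed for implicit differentiation. The minus sign before \<open>cross\<close> comes from
  differentiating the denominator \<open>t $ i\<close>.\<close>

lemma has_derivative_gradient_joint:
  assumes \<theta>: "\<theta> \<in> U" and t: "\<And>i. t $ i > 0"
  shows "((\<lambda>p. gradient (snd p) (fst p)) has_derivative
           (\<lambda>(u, h). hessian t \<theta> *v u + - (cross t \<theta> *v h))) (at (\<theta>, t))"
proof (rule has_derivative_vecI)
  fix j
  have t0: "t $ i \<noteq> 0" for i using t[of i] by simp
  have pos: "S \<theta> $ i / t $ i > 0" for i using S_pos[OF \<theta>] t by simp
  have S: "((\<lambda>p. S (fst p) $ i) has_derivative (\<lambda>q. \<Sum>l\<in>UNIV. J S \<theta> $ i $ l * fst q $ l)) (at (\<theta>, t))"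
    and JS: "((\<lambda>p. J S (fst p) $ i $ j) has_derivative
        (\<lambda>q. \<Sum>l\<in>UNIV. J2 S \<theta> $ (j, i) $ l * fst q $ l)) (at (\<theta>, t))" for i
    using has_derivative_compose[OF has_derivative_fst[OF has_derivative_ident[of "at (\<theta>, t)"]],
        of "\<lambda>\<theta>. S \<theta> $ i"] has_derivative_S[OF \<theta>, of i]
      has_derivative_compose[OF has_derivative_fst[OF has_derivative_ident[of "at (\<theta>, t)"]],
        of "\<lambda>\<theta>. J S \<theta> $ i $ j"] has_derivative_J_S[OF \<theta>, of i j]
    by simp_all
  have T: "((\<lambda>p. snd p $ i) has_derivative (\<lambda>q. snd q $ i)) (at (\<theta>, t))" for i
    by (intro has_derivative_vec_nth has_derivative_snd has_derivative_ident)
  have "((\<lambda>p. deriv \<phi> (S (fst p) $ i / snd p $ i) * J S (fst p) $ i $ j) has_derivative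
      (\<lambda>q. (deriv (deriv \<phi>) (S \<theta> $ i / t $ i) *
           ((\<Sum>l\<in>UNIV. J S \<theta> $ i $ l * fst q $ l) / t $ i - S \<theta> $ i * snd q $ i / (t $ i)\<^sup>2))
             * J S \<theta> $ i $ j
        + deriv \<phi> (S \<theta> $ i / t $ i) * (\<Sum>l\<in>UNIV. J2 S \<theta> $ (j, i) $ l * fst q $ l))) (at (\<theta>, t))"
    (is "(_ has_derivative ?D i) _") for i
  proof -
    have "((\<lambda>p. S (fst p) $ i / snd p $ i) has_derivative
        (\<lambda>q. (\<Sum>l\<in>UNIV. J S \<theta> $ i $ l * fst q $ l) / t $ i - S \<theta> $ i * snd q $ i / (t $ i)\<^sup>2)) (at (\<theta>, t))"
      using has_derivative_divide'[OF S T, of i i] t0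
      by (simp add: field_simps power2_eq_square)
    then have "((\<lambda>p. deriv \<phi> (S (fst p) $ i / snd p $ i)) has_derivative
        (\<lambda>q. ((\<Sum>l\<in>UNIV. J S \<theta> $ i $ l * fst q $ l) / t $ i - S \<theta> $ i * snd q $ i / (t $ i)\<^sup>2)
          * deriv (deriv \<phi>) (S \<theta> $ i / t $ i))) (at (\<theta>, t))"
      using DERIV_compose_FDERIV[of "deriv \<phi>" "deriv (deriv \<phi>) (S \<theta> $ i / t $ i)"
          "\<lambda>p. S (fst p) $ i / snd p $ i" "(\<theta>, t)"] DERIV_deriv_phi[OF pos[of i]]
      by simp
    from has_derivative_mult[OF this JS[of i]] show ?thesis
      by (simp add: algebra_simps)
  qed
  then have "((\<lambda>p. gradient (snd p) (fst p) $ j) has_derivative (\<lambda>q. \<Sum>i\<in>UNIV. ?D i q)) (at (\<theta>, t))"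
    unfolding gradient_def vec_lambda_beta by (intro has_derivative_sum)
  moreover have "(\<Sum>i\<in>UNIV. ?D i (u, h)) = (hessian t \<theta> *v u + - (cross t \<theta> *v h)) $ j" for u h
  proof -
    \<comment> \<open>The contributions of \<open>u\<close> and \<open>h\<close> are separated.
      Exchanging the two sums in the former then produces
      \<open>hessian t \<theta> *v u\<close>.\<close>
    have "(\<Sum>i\<in>UNIV. ?D i (u, h)) =
      (\<Sum>i\<in>UNIV. \<Sum>l\<in>UNIV. (deriv (deriv \<phi>) (S \<theta> $ i / t $ i) / t $ i * J S \<theta> $ i $ l * J S \<theta> $ i $ j
        + deriv \<phi> (S \<theta> $ i / t $ i) * J2 S \<theta> $ (j, i) $ l) * u $ l)
      - (\<Sum>i\<in>UNIV. deriv (deriv \<phi>) (S \<theta> $ i / t $ i) * (S \<theta> $ i / (t $ i)\<^sup>2) * J S \<theta> $ i $ j * h $ i)"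
      unfolding sum_subtractf[symmetric]
      by (rule sum.cong)
        (simp_all add: algebra_simps sum_distrib_left sum_distrib_right sum_divide_distrib sum.distrib)
    also have "\<dots> = (hessian t \<theta> *v u + - (cross t \<theta> *v h)) $ j"
      unfolding hessian_def cross_def matrix_vector_mult_def
      by (subst sum.swap) (simp add: sum_distrib_right sum_negf)
    finally show ?thesis .
  qed
  ultimately show "((\<lambda>p. gradient (snd p) (fst p) $ j) has_derivative
      (\<lambda>q. (case q of (u, h) \<Rightarrow> hessian t \<theta> *v u + - (cross t \<theta> *v h)) $ j)) (at (\<theta>, t))"
    by (simp add: case_prod_beta' split: prod.split)
qed

text \<open>Freezing \<open>t\<close> means composing with
  \<open>\<theta> \<mapsto> (\<theta>, t)\<close>, which sets \<open>h = 0\<close> in the joint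
  derivative.\<close>

lemma has_derivative_gradient:
  assumes "\<theta> \<in> U" "\<And>i. t $ i > 0"
  shows "(gradient t has_derivative (\<lambda>u. hessian t \<theta> *v u)) (at \<theta>)"
  using has_derivative_compose[OF has_derivative_Pair[OF has_derivative_ident has_derivative_const]
      has_derivative_gradient_joint[OF assms]]
  by simp

section \<open>The divergence under the Jacobian and partial derivative operators\<close>

text \<open>As a map into \<open>real^1\<close>, the divergence has a Jacobian with a single row,
  the gradient. After vectorization the first index component is therefore the coordinate.\<close>

lemma
  assumes \<theta>: "\<theta> \<in> U" and t: "\<And>i. t $ i > 0" and D: "\<And>\<theta>. \<theta> \<in> U \<Longrightarrow> D \<theta> = divergence t \<theta>"
  shows differentiable_vec_divergence: "(\<lambda>\<theta>. vec (D \<theta>) :: real^1) differentiable (at \<theta>)"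
    and vectorize_J_vec_divergence:
      "vectorize (J (\<lambda>\<theta>. vec (D \<theta>) :: real^1) \<theta>) = (\<chi> p. gradient t \<theta> $ fst p)"
proof -
  have "((\<lambda>\<theta>. vec (divergence t \<theta>) :: real^1) has_derivative (\<lambda>h. (\<chi> i. gradient t \<theta>) *v h)) (at \<theta>)"
    using has_derivative_divergence[OF \<theta> t]
    by (intro has_derivative_vecI) (simp add: matrix_vector_mult_def inner_vec_def)
  note * = J_cong_open[OF open_U \<theta> _ this, of "\<lambda>\<theta>. vec (D \<theta>)"]
  show "(\<lambda>\<theta>. vec (D \<theta>) :: real^1) differentiable (at \<theta>)" by (rule *(1)) (simp add: D)
  have "J (\<lambda>\<theta>. vec (D \<theta>) :: real^1) \<theta> = (\<chi> i. gradient t \<theta>)" by (rule *(2)) (simp add: D)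
  then show "vectorize (J (\<lambda>\<theta>. vec (D \<theta>) :: real^1) \<theta>) = (\<chi> p. gradient t \<theta> $ fst p)"
    by (simp add: vectorize_def)
qed

text \<open>The vectorized Jacobian equals the gradient only on \<open>U\<close>. Openness of
  \<open>U\<close> suffices to differentiate this identity.\<close>

lemma
  assumes \<theta>: "\<theta> \<in> U" and t: "\<And>i. t $ i > 0" and D: "\<And>\<theta>. \<theta> \<in> U \<Longrightarrow> D \<theta> = divergence t \<theta>"
  shows twice_differentiable_vec_divergence:
      "(\<lambda>\<theta>. vectorize (J (\<lambda>\<theta>. vec (D \<theta>) :: real^1) \<theta>)) differentiable (at \<theta>)"
    and J2_real_divergence: "J2_real D \<theta> = hessian t \<theta>"
proof -
  have "((\<lambda>\<theta>. \<chi> p. gradient t \<theta> $ fst p) has_derivative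
      (\<lambda>h. (\<chi> p :: 'k \<times> 1. hessian t \<theta> $ fst p) *v h)) (at \<theta>)"
    using has_derivative_vec_nth[OF has_derivative_gradient[OF \<theta> t]]
    by (intro has_derivative_vecI) (simp add: matrix_vector_mult_def)
  note * = J_cong_open[OF open_U \<theta> _ this, of "\<lambda>\<theta>. vectorize (J (\<lambda>\<theta>. vec (D \<theta>) :: real^1) \<theta>)"]
  show "(\<lambda>\<theta>. vectorize (J (\<lambda>\<theta>. vec (D \<theta>) :: real^1) \<theta>)) differentiable (at \<theta>)"
    by (rule *(1)) (simp add: vectorize_J_vec_divergence[OF _ t D])
  have "J2 (\<lambda>\<theta>. vec (D \<theta>) :: real^1) \<theta> = (\<chi> p. hessian t \<theta> $ fst p)"
    unfolding J2_def by (rule *(2)) (simp add: vectorize_J_vec_divergence[OF _ t D])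
  then show "J2_real D \<theta> = hessian t \<theta>"
    by (simp add: J2_real_def drop_unit_def vec_eq_iff)
qed

text \<open>The inner derivative selects component \<open>j\<close> of the gradient, that is, row
  \<open>j\<close> of \<open>hessian\<close>. The indices thus appear in reversed order, and no
  symmetry of second derivatives is invoked.\<close>

lemma partial_partial_divergence:
  assumes \<theta>: "\<theta> \<in> U" and t: "\<And>i. t $ i > 0" and D: "\<And>\<theta>. \<theta> \<in> U \<Longrightarrow> D \<theta> = divergence t \<theta>"
  shows "partial i (partial j D) \<theta> = hessian t \<theta> $ j $ i"
proof -
  have "partial j D \<theta> = gradient t \<theta> $ j" if "\<theta> \<in> U" for \<theta>
    using partial_eqI[OF has_derivative_transform_within_open[OF has_derivative_divergence[OF that t] open_U that]] D
    by (simp add: inner_axis)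
  then have "(partial j D has_derivative (\<lambda>u. (hessian t \<theta> *v u) $ j)) (at \<theta>)"
    using has_derivative_transform_within_open[OF has_derivative_vec_nth[OF has_derivative_gradient[OF \<theta> t]] open_U \<theta>]
    by simp
  from partial_eqI[OF this] show ?thesis
    by (simp add: matrix_vector_mult_basis column_def)
qed

section \<open>Matrix forms of the derivatives\<close>

text \<open>Right multiplication by a diagonal matrix scales columns. At \<open>t0\<close> and the
  optimal parameter, the diagonal factor is the matrix \<Delta> of the theorem.\<close>

lemma cross_eq:
  "cross t \<theta> = transpose (J S \<theta>) ** diag (\<chi> i. S \<theta> $ i / (t $ i)\<^sup>2 * deriv (deriv \<phi>) (S \<theta> $ i / t $ i))"
  unfolding cross_def matrix_matrix_mult_def diag_def transpose_def
  by (simp add: vec_eq_iff if_distrib cong: if_cong)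

text \<open>In the Kronecker product with the identity, row \<open>j\<close> vanishes outside block
  \<open>j\<close>. Only the second derivatives at positions \<open>(j, i)\<close> survive, weighted
  by the first derivative of \<open>\<phi>\<close>.\<close>

lemma hessian_eq:
  "hessian t \<theta> =
     transpose (J S \<theta>) ** diag (\<chi> i. 1 / t $ i * deriv (deriv \<phi>) (S \<theta> $ i / t $ i)) ** J S \<theta>
     + drop_unit (kronecker (mat 1 :: real^'k^'k)
         (transpose (columnvector (\<chi> i. deriv \<phi> (S \<theta> $ i / t $ i)) :: real^1^'m) :: real^'m^1) ** J2 S \<theta>)"
proof -
  have "(\<Sum>p\<in>UNIV. (if j = fst p then 1 else 0) * deriv \<phi> (S \<theta> $ snd p / t $ snd p) * J2 S \<theta> $ p $ l)
      = (\<Sum>i\<in>UNIV. deriv \<phi> (S \<theta> $ i / t $ i) * J2 S \<theta> $ (j, i) $ l)" for j l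
  proof -
    have "(\<Sum>p\<in>UNIV. (if j = fst p then 1 else 0) * deriv \<phi> (S \<theta> $ snd p / t $ snd p) * J2 S \<theta> $ p $ l)
      = (\<Sum>a\<in>UNIV. \<Sum>i\<in>UNIV. (if j = a then 1 else 0) * deriv \<phi> (S \<theta> $ i / t $ i) * J2 S \<theta> $ (a, i) $ l)"
      unfolding UNIV_Times_UNIV[symmetric] by (simp add: sum.cartesian_product case_prod_beta)
    also have "\<dots> = (\<Sum>a\<in>UNIV. if j = a then \<Sum>i\<in>UNIV. deriv \<phi> (S \<theta> $ i / t $ i) * J2 S \<theta> $ (a, i) $ l else 0)"
      by (rule sum.cong) auto
    finally show ?thesis by simp
  qed
  then show ?thesis
    unfolding hessian_def matrix_matrix_mult_def diag_def transpose_def drop_unit_def kronecker_def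
      columnvector_def mat_def
    by (simp add: vec_eq_iff if_distrib sum.distrib mult_ac cong: if_cong)
qed

end

section \<open>Differentiability of the optimal parameter\<close>

theorem theorem19:
  fixes \<phi> :: "real \<Rightarrow> real"
    and \<Theta> :: "(real^'k) set"
    and S :: "real^'k \<Rightarrow> real^'m"
    and t0 :: "real^'m"
    and N :: "(real^'m) set"
    and \<theta>opt :: "real^'m \<Rightarrow> real^'k"
  assumes phi_convex: "convex_on {0..} \<phi>"
    and phi_cont_0: "continuous (at 0 within {0..}) \<phi>"
    and phi_strict_convex: "strict_convex_on {0<..} \<phi>"
    and phi_diff: "\<forall>x>0. \<phi> differentiable (at x)"
    and phi_diff2: "\<forall>x>0. deriv \<phi> differentiable (at x)"
    and phi_C2: "continuous_on {0<..} (deriv (deriv \<phi>))"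
    and dim_le: "CARD('k) \<le> CARD('m)"
    and Theta_bounded: "bounded \<Theta>"
    and Theta_interior: "interior \<Theta> \<noteq> {}"
    and S_range: "\<forall>\<theta>\<in>closure \<Theta>. \<forall>i. S \<theta> $ i \<in> {0..1}"
    and S_cont: "continuous_on (closure \<Theta>) S"
    and S_inj: "inj_on S (closure \<Theta>)"
    and S_C2: "twice_cont_diff_on (interior \<Theta>) S"
    and S_range_interior: "\<forall>\<theta>\<in>interior \<Theta>. \<forall>i. S \<theta> $ i \<in> {0<..<1}"
    and t0_range: "\<forall>i. t0 $ i \<in> {0<..<1}"
    and N_nhd: "open N" "t0 \<in> N" "\<forall>t\<in>N. \<forall>i. t $ i \<in> {0<..<1}"
    and proj_unique: "\<forall>t\<in>N. \<exists>!s. is_phi_projection \<phi> (S ` closure \<Theta>) t s"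
    and proj_interior: "\<forall>t\<in>N. \<forall>s. is_phi_projection \<phi> (S ` closure \<Theta>) t s \<longrightarrow>
                          (\<exists>!\<theta>. \<theta> \<in> interior \<Theta> \<and> s = S \<theta>)"
    and \<theta>opt: "\<forall>t\<in>N. is_arg_min (\<lambda>\<theta>. phi_divergence \<phi> (S \<theta>) t) (\<lambda>\<theta>. \<theta> \<in> interior \<Theta>) (\<theta>opt t)"
    and hessian_pos_definite: "pos_definite
          (\<chi> i j. partial i (partial j (param_divergence \<phi> S t0)) (\<theta>opt t0))"
  shows "cont_diff_at \<theta>opt t0 \<and>
         invertible (J2_real (param_divergence \<phi> S t0) (\<theta>opt t0)) \<and>
         J \<theta>opt t0 =
           matrix_inv (J2_real (param_divergence \<phi> S t0) (\<theta>opt t0))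
           ** transpose (J S (\<theta>opt t0))
           ** diag (\<chi> i. S (\<theta>opt t0) $ i / (t0 $ i)\<^sup>2 * deriv (deriv \<phi>) (S (\<theta>opt t0) $ i / t0 $ i)) \<and>
         twice_diff_on (interior \<Theta>) (\<lambda>\<theta>. vec (param_divergence \<phi> S t0 \<theta>) :: real^1) \<and>
         (\<forall>\<theta>\<in>interior \<Theta>.
           J2_real (param_divergence \<phi> S t0) \<theta> =
             transpose (J S \<theta>)
             ** diag (\<chi> i. 1 / t0 $ i * deriv (deriv \<phi>) (S \<theta> $ i / t0 $ i))
             ** J S \<theta>
             + drop_unit
                 (kronecker (mat 1 :: real^'k^'k)
                    (transpose (columnvector (\<chi> i. deriv \<phi> (S \<theta> $ i / t0 $ i)) :: real^1^'m) :: real^'m^1)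
                  ** J2 S \<theta>))"
proof -
  interpret parametric_divergence \<phi> S "interior \<Theta>"
    using phi_diff phi_diff2 phi_C2 S_C2 S_range_interior by unfold_locales auto
  have t_pos: "t $ i > 0" if "t \<in> N" for t i using N_nhd(3) that by auto
  note t0_pos = t_pos[OF N_nhd(2)]
  have phi_div: "phi_divergence \<phi> (S \<theta>) t = ereal (divergence t \<theta>)" if "t \<in> N" for t \<theta>
    using t_pos[OF that] by (simp add: phi_divergence_def divergence_term_def divergence_def)
  have param_div: "param_divergence \<phi> S t0 \<theta> = divergence t0 \<theta>" for \<theta>
    by (simp add: param_divergence_def phi_div N_nhd(2))

  have opt_in: "\<theta>opt t \<in> interior \<Theta>"
    and opt_min: "\<And>\<theta>. \<theta> \<in> interior \<Theta> \<Longrightarrow> divergence t (\<theta>opt t) \<le> divergence t \<theta>" if "t \<in> N" for t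
    using \<theta>opt that phi_div[OF that] by (force simp: is_arg_min_def)+
  have int_clos: "\<theta> \<in> closure \<Theta>" if "\<theta> \<in> interior \<Theta>" for \<theta>
    using that closure_subset interior_subset by blast
  \<comment> \<open>\<open>\<theta>opt t\<close> is given as a minimizer over the interior only. The
    projection minimizes over the closure and has its parameter in the interior, so both minima
    coincide.\<close>
  have opt_min_closure: "divergence t (\<theta>opt t) \<le> divergence t \<theta>" if t: "t \<in> N" and \<theta>: "\<theta> \<in> closure \<Theta>" for t \<theta>
  proof -
    obtain s where s: "is_phi_projection \<phi> (S ` closure \<Theta>) t s" using proj_unique t by blast
    then obtain \<theta>' where \<theta>': "\<theta>' \<in> interior \<Theta>" "s = S \<theta>'" using proj_interior t by blast
    have "phi_divergence \<phi> s t \<le> phi_divergence \<phi> (S \<theta>) t"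
      using s \<theta> by (auto simp: is_phi_projection_def intro: INF_lower)
    then have "divergence t \<theta>' \<le> divergence t \<theta>" by (simp add: \<theta>'(2) phi_div t)
    with opt_min[OF t \<theta>'(1)] show ?thesis by simp
  qed
  have projection: "is_phi_projection \<phi> (S ` closure \<Theta>) t (S y)"
    if "t \<in> N" "y \<in> closure \<Theta>" "divergence t y \<le> divergence t (\<theta>opt t)" for t y
    unfolding is_phi_projection_def
  proof (intro conjI antisym INF_greatest INF_lower imageI that(2))
    fix s assume "s \<in> S ` closure \<Theta>"
    then obtain z where z: "z \<in> closure \<Theta>" "s = S z" by blast
    then show "phi_divergence \<phi> (S y) t \<le> phi_divergence \<phi> s t"
      using that(3) opt_min_closure[OF that(1) z(1)] by (simp add: phi_div that(1))
  qed
  \<comment> \<open>Any \<open>y\<close> that does as well as \<open>\<theta>opt t\<close> yields a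
    projection too. Uniqueness of the projection and injectivity of \<open>S\<close> identify the
    parameters.\<close>
  have opt_unique: "y = \<theta>opt t"
    if "t \<in> N" "y \<in> closure \<Theta>" "divergence t y \<le> divergence t (\<theta>opt t)" for t y
  proof -
    have "S y = S (\<theta>opt t)"
      using proj_unique that projection[OF that] projection[OF that(1) int_clos[OF opt_in]] by blast
    then show ?thesis using inj_onD[OF S_inj] that(2) int_clos[OF opt_in[OF that(1)]] by blast
  qed
  \<comment> \<open>The point 0 must be included, since components of \<open>S\<close> may vanish on
    the boundary of the parameter set.\<close>
  have phi_cont: "continuous_on {0..} \<phi>"
    unfolding continuous_on_eq_continuous_within
  proof
    fix x :: real assume "x \<in> {0..}"
    show "continuous (at x within {0..}) \<phi>"
    proof (cases "x = 0")
      case False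
      then have "isCont \<phi> x" using \<open>x \<in> {0..}\<close> by (intro DERIV_isCont[OF DERIV_phi]) simp
      then show ?thesis by (rule continuous_at_imp_continuous_at_within)
    qed (use phi_cont_0 in simp)
  qed
  have "continuous_on (N \<times> closure \<Theta>) (\<lambda>p. fst p $ i * \<phi> (S (snd p) $ i / fst p $ i))" for i
  proof -
    have t: "continuous_on (N \<times> closure \<Theta>) (\<lambda>p. fst p $ i)"
      by (intro continuous_on_component continuous_on_fst continuous_on_id)
    have "continuous_on (N \<times> closure \<Theta>) (\<lambda>p. S (snd p) $ i)"
      by (intro continuous_on_component continuous_on_compose2[OF S_cont continuous_on_snd[OF continuous_on_id]]) auto
    then have "continuous_on (N \<times> closure \<Theta>) (\<lambda>p. S (snd p) $ i / fst p $ i)"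
      using t by (rule continuous_on_divide) (auto dest: t_pos[of _ i])
    moreover have "(\<lambda>p. S (snd p) $ i / fst p $ i) ` (N \<times> closure \<Theta>) \<subseteq> {0..}"
      using S_range t_pos[of _ i] by (force intro!: divide_nonneg_pos)
    ultimately show ?thesis
      by (intro continuous_on_mult[OF t] continuous_on_compose2[OF phi_cont])
  qed
  then have "continuous_on (N \<times> closure \<Theta>) (\<lambda>p. divergence (fst p) (snd p))"
    unfolding divergence_def by (intro continuous_on_sum)
  then have "continuous_on N \<theta>opt"
    using Theta_bounded
    by (intro continuous_on_unique_minimizer[of "closure \<Theta>" N "\<lambda>p. divergence (fst p) (snd p)"])
      (auto simp: int_clos opt_in opt_min_closure opt_unique)
  then have opt_isCont: "isCont \<theta>opt t" if "t \<in> N" for t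
    using that N_nhd(1) by (simp add: continuous_on_eq_continuous_at)

  \<comment> \<open>\<open>\<theta>opt t\<close> is a minimizer in an open set, so the derivative of
    the divergence vanishes there.\<close>
  have gradient_zero: "gradient t (\<theta>opt t) = 0" if "t \<in> N" for t
  proof -
    have "(\<lambda>h. gradient t (\<theta>opt t) \<bullet> h) = (\<lambda>h. 0)"
      using opt_min[OF that]
      by (intro differential_zero_maxmin[OF opt_in[OF that] open_U
            has_derivative_divergence[OF opt_in[OF that] t_pos[OF that]]]) auto
    then show ?thesis by (metis inner_eq_zero_iff)
  qed
  let ?H = "\<lambda>t. hessian t (\<theta>opt t)" and ?C = "\<lambda>t. cross t (\<theta>opt t)"
  have opt_deriv: "(\<theta>opt has_derivative (\<lambda>h. (matrix_inv (?H t) ** ?C t) *v h)) (at t)"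
    if t: "t \<in> N" and inv: "invertible (?H t)" for t
  proof -
    have "\<forall>\<^sub>F s in nhds t. gradient (snd (\<theta>opt s, s)) (fst (\<theta>opt s, s)) = 0"
      using eventually_nhds_in_open[OF N_nhd(1) t] by eventually_elim (simp add: gradient_zero)
    from has_derivative_implicit[OF has_derivative_gradient_joint[OF opt_in[OF t] t_pos[OF t]] opt_isCont[OF t] this
        matrix_vector_mul_bounded_linear, of "matrix_inv (?H t)"]
    have "(\<theta>opt has_derivative (\<lambda>h. - (matrix_inv (?H t) *v (- (?C t *v h))))) (at t)"
      using inv by (simp add: matrix_vector_mul_assoc matrix_inv_left)
    moreover have "- (matrix_inv (?H t) *v (- v)) = matrix_inv (?H t) *v v" for v
      using linear_neg[OF matrix_vector_mul_linear[of "matrix_inv (?H t)"]] by simp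
    ultimately show ?thesis by (simp add: matrix_vector_mul_assoc)
  qed

  \<comment> \<open>The transpose reflects the reversed index order of iterated partial
    derivatives.\<close>
  have P: "(\<chi> i j. partial i (partial j (param_divergence \<phi> S t0)) (\<theta>opt t0)) = transpose (?H t0)"
    using partial_partial_divergence[OF opt_in[OF N_nhd(2)] t0_pos, of "param_divergence \<phi> S t0"] param_div
    by (simp add: transpose_def vec_eq_iff)
  \<comment> \<open>\<open>pos_definite\<close> includes symmetry, which removes the transpose. A
    kernel vector \<open>x\<close> then satisfies \<open>x \<bullet> (?H t0 *v x) = 0\<close>, hence
    is zero.\<close>
  have inv: "invertible (?H t0)"
  proof -
    have "x = 0" if "?H t0 *v x = 0" for x
      using that hessian_pos_definite unfolding P pos_definite_def
      by (metis inner_zero_right less_irrefl transpose_transpose)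
    then show ?thesis
      using invertible_left_inverse matrix_left_invertible_ker by blast
  qed
  have contHC: "isCont (\<lambda>t. ?H t $ i $ j) t0" "isCont (\<lambda>t. ?C t $ i $ l) t0" for i j l
    using isCont_hessian_cross[OF opt_isCont[OF N_nhd(2)] opt_in[OF N_nhd(2)] t0_pos] by auto
  have detH: "det (?H t0) \<noteq> 0" using inv by (simp add: invertible_det_nz)
  \<comment> \<open>Invertibility is known at \<open>t0\<close> alone. Continuity of the determinant
    spreads it to a neighbourhood \<open>W\<close>, on which \<open>opt_deriv\<close> gives the
    Jacobian.\<close>
  have "\<forall>\<^sub>F t in nhds t0. t \<in> N \<and> det (?H t) \<noteq> 0"
    using tendsto_imp_eventually_ne[OF isCont_det[OF contHC(1), unfolded isCont_def] detH] detH
      eventually_nhds_in_open[OF N_nhd(1,2)]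
    by (intro eventually_conj) (simp_all add: eventually_nhds_conv_at)
  then obtain W where W: "open W" "t0 \<in> W" "\<And>t. t \<in> W \<Longrightarrow> t \<in> N \<and> invertible (?H t)"
    unfolding eventually_nhds invertible_det_nz by blast
  have "isCont (\<lambda>t. matrix_inv (?H t) ** ?C t) t0"
    by (intro isCont_vecI)
      (simp add: matrix_matrix_mult_def, intro continuous_intros isCont_matrix_inv contHC detH)
  \<comment> \<open>Since the formula for the Jacobian holds on all of \<open>W\<close>, its
    continuity at \<open>t0\<close> carries over to \<open>J \<theta>opt\<close>.\<close>
  moreover have "\<forall>\<^sub>F t in nhds t0. J \<theta>opt t = matrix_inv (?H t) ** ?C t"
    using eventually_nhds_in_open[OF W(1,2)]
    by eventually_elim (use W(3) in \<open>blast intro: J_eqI opt_deriv\<close>)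
  ultimately have "isCont (J \<theta>opt) t0" by (simp add: isCont_cong)
  moreover have "\<theta>opt differentiable (at t)" if "t \<in> W" for t
    using W(3)[OF that] opt_deriv by (blast intro: differentiableI)
  ultimately have "cont_diff_at \<theta>opt t0" using W(1,2) by (auto simp: cont_diff_at_def)
  moreover have J2: "J2_real (param_divergence \<phi> S t0) \<theta> = hessian t0 \<theta>" if "\<theta> \<in> interior \<Theta>" for \<theta>
    by (rule J2_real_divergence[OF that t0_pos param_div])
  moreover have "J \<theta>opt t0 = matrix_inv (?H t0) ** ?C t0"
    by (rule J_eqI[OF opt_deriv[OF N_nhd(2) inv]])
  moreover have "twice_diff_on (interior \<Theta>) (\<lambda>\<theta>. vec (param_divergence \<phi> S t0 \<theta>) :: real^1)"
    unfolding twice_diff_on_def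
    using differentiable_vec_divergence[OF _ t0_pos param_div]
      twice_differentiable_vec_divergence[OF _ t0_pos param_div] by blast
  ultimately show ?thesis
    using inv opt_in[OF N_nhd(2)] hessian_eq[of t0]
    by (simp add: J2 cross_eq matrix_mul_assoc)
qed

end
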